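(* For every positive integer $n$ and every string $x$ of length $n$ over a finite alphabet, the number of distinct squares in $x$ is at most $\lfloor 11n/6\rfloor$.
   Context: Strings are finite, over a finite alphabet. A square is a string of the form $u^2=uu$ with $u$ non-empty. The number of distinct squares in $x$ counts types of squares rather than occurrences, i.e. it is the number of distinct strings $uu$ ($u$ non-empty) that occur as a (contiguous) factor of $x$. *)

theory Defs
  imports Complex_Main "HOL-Library.Sublist"
begin

definition is_square :: "'a list \<Rightarrow> bool" where
  "is_square w \<longleftrightarrow> (\<exists>u. u \<noteq> [] \<and> w = u @ u)"

definition distinct_squares :: "'a list \<Rightarrow> 'a list set" where
  "distinct_squares x = {w. is_square w \<and> sublist w x}"

(* Guarantees that taking card of this set is a genuine count. *)
lemma finite_distinct_squares: "finite (distinct_squares x)"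
  by (rule finite_subset[of _ "set (sublists x)"]) (auto simp: distinct_squares_def)

end

theory Submission
  imports Defs "HOL-Library.List_Lexorder"
begin

text \<open>Following Brlek and Li, a word of length \<open>n > 0\<close> has in fact fewer than \<open>n\<close> distinct squares.
  The Rauzy graph of order \<open>m\<close> has the factors of length \<open>m\<close> as vertices and those of length
  \<open>m + 1\<close> as edges. Every primitive conjugacy class \<open>[q]\<close> with \<open>|q| \<le> m\<close> all of whose periodic
  factors of length \<open>m + 1\<close> occur yields a circuit. If \<open>q\<close> is the Lyndon word of its class, the edge
  starting with \<open>q\<close> has minimal period \<open>|q|\<close>, so it lies on no shorter circuit of this kind; hence
  the circuits are independent and their number is at most the cyclomatic number. Summing over
  \<open>m\<close> telescopes to at most \<open>n - 1\<close> circuits. Finally, if \<open>a\<close> conjugates \<open>r\<close> of \<open>q\<close> have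
  \<open>r\<^sup>2\<^sup>j\<close> as a factor of the word, then \<open>q\<close> gives a circuit in each of the orders
  \<open>(2j - 1)|q|, \<dots>, (2j - 1)|q| + a - 1\<close>, so there are at least as many circuits as squares.\<close>

section \<open>Factors of periodic words\<close>

text \<open>The factor of length \<open>l\<close> at position \<open>i\<close> of the infinite word \<open>q q q \<dots>\<close>\<close>
definition cyc :: "'a list \<Rightarrow> nat \<Rightarrow> nat \<Rightarrow> 'a list" where
  "cyc q i l = map (\<lambda>k. q ! ((i + k) mod length q)) [0..<l]"

lemma length_cyc [simp]: "length (cyc q i l) = l"
  by (simp add: cyc_def)

lemma nth_cyc [simp]: "k < l \<Longrightarrow> cyc q i l ! k = q ! ((i + k) mod length q)"
  by (simp add: cyc_def)

lemma take_cyc: "m \<le> l \<Longrightarrow> take m (cyc q i l) = cyc q i m"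
  by (rule nth_equalityI) auto

lemma drop_cyc: "drop m (cyc q i l) = cyc q (i + m) (l - m)"
  by (rule nth_equalityI) (auto simp: add.assoc)

lemma cyc_append: "cyc q i (l + m) = cyc q i l @ cyc q (i + l) m"
  by (rule nth_equalityI) (auto simp: nth_append)

lemma cyc_mod [simp]: "cyc q (i mod length q) l = cyc q i l"
  by (rule nth_equalityI) (auto simp: mod_add_left_eq)

lemma cyc_add_length [simp]: "cyc q (i + length q) l = cyc q i l"
  by (metis cyc_mod mod_add_self2)

lemma cyc_0 [simp]: "cyc q 0 (length q) = q"
  by (rule nth_equalityI) auto

lemma cyc_cyc: "q \<noteq> [] \<Longrightarrow> cyc (cyc q i (length q)) j l = cyc q (i + j) l"
  by (rule nth_equalityI) (auto simp: mod_add_right_eq add.assoc)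

lemma cyc_eq_append: "i \<le> length q \<Longrightarrow> cyc q i (length q) = drop i q @ take i q"
  using cyc_append[of q i "length q - i" i] drop_cyc[of i q 0 "length q"]
    take_cyc[of i "length q" q 0] cyc_add_length[of q 0 i]
  by simp

lemma sublist_cyc:
  assumes "i' + l' \<le> i + l" "i \<le> i'"
  shows "sublist (cyc q i' l') (cyc q i l)"
proof -
  have "cyc q i' l' = take l' (drop (i' - i) (cyc q i l))"
    using assms by (simp add: drop_cyc take_cyc)
  then show ?thesis
    by (metis sublist_drop sublist_order.dual_order.trans sublist_take)
qed


section \<open>Lyndon words\<close>

lemma append_less_append_left [simp]: "z @ x < z @ y \<longleftrightarrow> x < (y :: 'a :: linorder list)"
  by (induction z) auto

lemma append_less_imp_le:
  fixes x y :: "'a :: linorder list"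
  shows "length x = length y \<Longrightarrow> x @ u < y @ v \<Longrightarrow> x \<le> y"
  by (induction x y rule: list_induct2) auto

text \<open>Strictness rules out proper powers: a Lyndon word is primitive and the unique least word
  among its rotations.\<close>

definition lyndon :: "'a :: linorder list \<Rightarrow> bool" where
  "lyndon q \<longleftrightarrow> q \<noteq> [] \<and> (\<forall>i. 0 < i \<and> i < length q \<longrightarrow> q < cyc q i (length q))"

text \<open>A period \<open>r\<close> yields a border \<open>z\<close>. Comparing \<open>q\<close>
  with its rotations by \<open>r\<close> and by \<open>p - r\<close> gives contradictory
  inequalities between its prefix and suffix of length \<open>r\<close>.\<close>

lemma lyndon_no_period:
  assumes "lyndon q" "0 < r" "r < length q"
  shows "\<exists>k. k + r < length q \<and> q ! k \<noteq> q ! (k + r)"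
proof (rule ccontr)
  assume *: "\<not> ?thesis"
  define p z where "p = length q" and "z = drop r q"
  have z: "z = take (p - r) q"
    by (rule nth_equalityI) (use * assms in \<open>auto simp: z_def p_def add.commute\<close>)
  have 1: "q = z @ drop (p - r) q" "q = take r q @ z"
    using append_take_drop_id[of "p - r" q] append_take_drop_id[of r q]
    unfolding z[symmetric] unfolding z_def by simp_all
  have "q < cyc q r p" "q < cyc q (p - r) p"
    using assms by (auto simp: lyndon_def p_def)
  then have "q < z @ take r q" "q < drop (p - r) q @ z"
    using cyc_eq_append[of r q] cyc_eq_append[of "p - r" q] assms(3)
    unfolding z[symmetric] unfolding z_def by (simp_all add: p_def)
  then have "z @ drop (p - r) q < z @ take r q" "take r q @ z < drop (p - r) q @ z"
    using 1 by metis+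
  then show False
    using append_less_imp_le[of "take r q" "drop (p - r) q" z z] assms
    by (auto simp: p_def)
qed

text \<open>Two different Lyndon conjugates would each be strictly below the other.\<close>

lemma lyndon_conjugate_eq:
  assumes "lyndon q" "lyndon (cyc q i (length q))"
  shows "cyc q i (length q) = q"
proof -
  define p j where "p = length q" and "j = i mod p"
  have p: "0 < p" using assms by (auto simp: lyndon_def p_def)
  have eq: "cyc q i p = cyc q j p" by (simp add: j_def p_def)
  show ?thesis
  proof (cases "j = 0")
    case True
    then show ?thesis using eq by (simp add: p_def)
  next
    case False
    have "j < p" using p by (simp add: j_def)
    have "q < cyc q j p"
      using assms(1) False \<open>j < p\<close> by (auto simp: lyndon_def p_def)
    moreover have "cyc q j p < cyc (cyc q j p) (p - j) p"
      using assms(2) False \<open>j < p\<close> eq by (auto simp: lyndon_def p_def)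
    moreover have "cyc (cyc q j p) (p - j) p = q"
      using \<open>j < p\<close> cyc_add_length[of q 0 p] p by (auto simp: p_def cyc_cyc simp del: cyc_add_length)
    ultimately show ?thesis by simp
  qed
qed

text \<open>If \<open>q'\<close> were shorter, its length would be a period of
  \<open>q\<close>.\<close>

lemma lyndon_length_le:
  assumes "lyndon q" "q' \<noteq> []" "cyc q 0 l = cyc q' i l" "length q \<le> l"
  shows "length q \<le> length q'"
proof (rule ccontr)
  assume "\<not> ?thesis"
  then obtain k where k: "k + length q' < length q" "q ! k \<noteq> q ! (k + length q')"
    using lyndon_no_period[OF assms(1), of "length q'"] assms(2) by auto
  have "q ! n = q' ! ((i + n) mod length q')" if "n < length q" for n
    using arg_cong[OF assms(3), of "\<lambda>x. x ! n"] that assms(4) by simp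
  from this[of k] this[of "k + length q'"] k show False
    by (simp flip: add.assoc)
qed

lemma lyndon_eqI:
  assumes "lyndon q" "lyndon q'" "cyc q 0 l = cyc q' i l" "length q = length q'" "length q \<le> l"
  shows "q = q'"
proof -
  have "q = cyc q' i (length q)"
    using arg_cong[OF assms(3), of "take (length q)"] assms(5) by (simp add: take_cyc)
  then show ?thesis
    using lyndon_conjugate_eq[of q' i] assms(1,2,4) by simp
qed

text \<open>The edge starting with \<open>q\<close> is thus met only once in a turn around its own
  circuit.\<close>

lemma lyndon_cyc_0_neq:
  assumes "lyndon q" "0 < i" "i < length q" "length q \<le> l"
  shows "cyc q i l \<noteq> cyc q 0 l"
proof
  assume *: "cyc q i l = cyc q 0 l"
  have "cyc q i (length q) = q"
    using arg_cong[OF *, of "take (length q)"] assms(4) by (simp add: take_cyc)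
  moreover have "q < cyc q i (length q)"
    using assms by (auto simp: lyndon_def)
  ultimately show False by simp
qed

section \<open>Periods and primitive roots\<close>

lemma period_mult:
  fixes s :: "nat \<Rightarrow> 'a"
  assumes "\<And>k. s (k + d) = s k"
  shows "s (k + d * m) = s k"
proof (induction m)
  case (Suc m)
  have "s (k + d * Suc m) = s (k + d * m + d)" by (simp add: algebra_simps)
  then show ?case using assms Suc by metis
qed simp

text \<open>The infinite word over \<open>q\<close> has the periods \<open>i\<close> and
  \<open>length q\<close>, hence by Bezout also their gcd.\<close>

lemma cyc_eq_gcd_period:
  assumes "q \<noteq> []" "cyc q i (length q) = q" "0 < i"
  shows "q = cyc (take (gcd i (length q)) q) 0 (length q)"
proof -
  define p s where "p = length q" and "s k = q ! (k mod p)" for k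
  have "s (k + i) = s k" for k
    using arg_cong[OF assms(2), of "\<lambda>x. x ! (k mod p)"] assms(1)
    by (simp add: s_def p_def mod_simps add.commute)
  then have i: "s (k + i * x) = s k" for k x
    by (rule period_mult)
  have p: "s (k + p * y) = s k" for k y
    by (simp add: s_def)
  obtain x y where xy: "i * x = p * y + gcd i p"
    using bezout_nat[of i p] assms(3) by auto
  have d: "s (k + gcd i p) = s k" for k
    using i[of k x] p[of "k + gcd i p" y] by (simp add: xy add_ac)
  have d': "s (k + gcd i p * m) = s k" for k m
    using d by (rule period_mult)
  have "gcd i p \<le> p" using assms by (auto simp: p_def intro: gcd_le2_nat)
  have pos: "gcd i p > 0" using assms by simp
  show ?thesis
  proof (rule nth_equalityI)
    fix k assume k: "k < length q"
    have "q ! k = s (k mod gcd i p + gcd i p * (k div gcd i p))"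
      using k by (simp add: s_def p_def)
    also have "\<dots> = s (k mod gcd i p)" by (rule d')
    also have "\<dots> = q ! (k mod gcd i p)"
      using pos \<open>gcd i p \<le> p\<close> by (simp add: s_def order_less_le_trans[OF mod_less_divisor])
    finally show "q ! k = cyc (take (gcd i (length q)) q) 0 (length q) ! k"
      using k pos \<open>gcd i p \<le> p\<close> by (simp add: p_def min_absorb2)
  qed simp
qed

lemma cyc_of_cyc_root:
  assumes "r \<noteq> []" "q = cyc r 0 (length q)" "length r dvd length q" "q \<noteq> []"
  shows "cyc q i l = cyc r i l"
proof (rule nth_equalityI)
  fix k assume "k < length (cyc q i l)"
  then have "cyc q i l ! k = q ! ((i + k) mod length q)" by simp
  also have "\<dots> = cyc r 0 (length q) ! ((i + k) mod length q)"
    using assms(2) by metis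
  also have "\<dots> = r ! ((i + k) mod length r)"
    using assms(3,4) by (simp add: mod_mod_cancel del: cyc_0)
  finally show "cyc q i l ! k = cyc r i l ! k"
    using \<open>k < length (cyc q i l)\<close> by simp
qed simp

text \<open>Take a shortest root of \<open>u\<close> up to rotation, then the least of its
  rotations.\<close>

lemma lyndon_root:
  fixes u :: "'a :: linorder list"
  assumes "u \<noteq> []"
  obtains q i j where "lyndon q" "i < length q" "0 < j" "u = cyc q i (j * length q)"
proof -
  define P where "P p \<longleftrightarrow> (\<exists>q i. length q = p \<and> q \<noteq> [] \<and> p dvd length u \<and> u = cyc q i (length u))" for p
  define p where "p = (LEAST p. P p)"
  have "P (length u)"
    unfolding P_def using assms by (intro exI[of _ u] exI[of _ 0]) simp
  then have "P p" unfolding p_def by (rule LeastI)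
  have min: "p \<le> p'" if "P p'" for p' unfolding p_def using that by (rule Least_le)
  obtain q i where q: "length q = p" "q \<noteq> []" "p dvd length u" "u = cyc q i (length u)"
    using \<open>P p\<close> by (auto simp: P_def)
  define C where "C = (\<lambda>k. cyc q k p) ` {..<p}"
  have "finite C" "C \<noteq> {}" using q by (auto simp: C_def)
  define v where "v = Min C"
  have "v \<in> C" unfolding v_def using \<open>finite C\<close> \<open>C \<noteq> {}\<close> by (rule Min_in)
  then obtain k where k: "k < p" "v = cyc q k p" by (auto simp: C_def)
  have lv: "length v = p" "v \<noteq> []" using k q by (auto simp flip: length_0_conv)
  have u: "u = cyc v (i + (p - k)) (length u)"
    using q k cyc_add_length[of q i] by (simp add: cyc_cyc k(2) flip: q(1))
  have "lyndon v"
    unfolding lyndon_def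
  proof (intro conjI allI impI)
    fix d assume d: "0 < d \<and> d < length v"
    have "cyc v d p = cyc q ((k + d) mod p) p"
      using q k by (simp add: cyc_cyc flip: q(1))
    then have "cyc v d p \<in> C" using k by (auto simp: C_def)
    then have "v \<le> cyc v d p" unfolding v_def using \<open>finite C\<close> by simp
    \<comment> \<open>Otherwise the prefix of length \<open>gcd d p\<close> is a shorter root,
      against the minimality of \<open>p\<close>.\<close>
    moreover have "cyc v d p \<noteq> v"
    proof
      assume *: "cyc v d p = v"
      define g r where "g = gcd d p" and "r = take g v"
      have r: "v = cyc r 0 (length v)"
        using cyc_eq_gcd_period[OF lv(2), of d] * d lv by (simp add: g_def r_def)
      have g: "g dvd p" "g > 0" "g < p"
        using d lv gcd_le1_nat[of d p] by (auto simp: g_def simp del: gcd_le1_nat)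
      have lr: "length r = g" "r \<noteq> []" using lv g by (auto simp: r_def)
      have "cyc v (i + (p - k)) (length u) = cyc r (i + (p - k)) (length u)"
        using cyc_of_cyc_root[OF lr(2) r] lv(1,2) lr(1) g(1) by blast
      with u have "u = cyc r (i + (p - k)) (length u)" by (rule trans)
      then have "P g" unfolding P_def using lr g q dvd_trans by blast
      then show False using min[of g] g by simp
    qed
    ultimately show "v < cyc v d (length v)" using lv by simp
  qed (use lv in simp)
  moreover obtain j where j: "length u = p * j" using q(3) by (elim dvdE)
  have "0 < j" using assms j by (cases j) auto
  moreover have "u = cyc v ((i + (p - k)) mod length v) (j * length v)"
    using trans[OF u cyc_mod[symmetric]] unfolding j lv(1) by (simp only: mult.commute)
  ultimately show ?thesis
    using that lv(2) by (metis length_greater_0_conv mod_less_divisor)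
qed


section \<open>Rauzy graphs\<close>

text \<open>As every cut is crossed by an edge, a tree can be grown by one vertex and one edge at a
  time until it spans \<open>V\<close>.\<close>

lemma card_le_Suc_card_connected:
  assumes "finite V" "finite F"
    and ends: "\<And>e. e \<in> F \<Longrightarrow> a e \<in> V \<and> b e \<in> V"
    and cut: "\<And>S. S \<subset> V \<Longrightarrow> S \<noteq> {} \<Longrightarrow> \<exists>e\<in>F. (a e \<in> S) \<noteq> (b e \<in> S)"
  shows "card V \<le> Suc (card F)"
proof -
  have tree: "\<exists>S T. S \<subseteq> V \<and> card S = Suc k \<and> T \<subseteq> F \<and> k \<le> card T \<and> (\<forall>e\<in>T. a e \<in> S \<and> b e \<in> S)"
    if "Suc k \<le> card V" for k
    using that
  proof (induction k)
    case 0
    then obtain v where "v \<in> V" by (cases "V = {}") auto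
    then show ?case by (intro exI[of _ "{v}"] exI[of _ "{}"]) auto
  next
    case (Suc k)
    then obtain S T where ST: "S \<subseteq> V" "card S = Suc k" "T \<subseteq> F" "k \<le> card T"
      "\<forall>e\<in>T. a e \<in> S \<and> b e \<in> S" by auto
    have fin: "finite S" "finite T" using ST assms(1,2) by (auto intro: finite_subset)
    have "S \<subset> V" "S \<noteq> {}" using ST Suc.prems by auto
    from cut[OF this] obtain e where e: "e \<in> F" "(a e \<in> S) \<noteq> (b e \<in> S)" by blast
    define v where "v = (if a e \<in> S then b e else a e)"
    have "v \<in> V" "v \<notin> S" using e(2) ends[OF e(1)] by (auto simp: v_def)
    moreover have "e \<notin> T" using e ST by auto
    ultimately show ?case using ST e fin
      by (intro exI[of _ "insert v S"] exI[of _ "insert e T"]) (auto simp: v_def)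
  qed
  show ?thesis
  proof (cases "card V")
    case (Suc k)
    then obtain T where "T \<subseteq> F" "k \<le> card T" using tree[of k] by auto
    then show ?thesis using card_mono[OF assms(2), of T] Suc by simp
  qed simp
qed

definition factors :: "'a list \<Rightarrow> nat \<Rightarrow> 'a list set" where
  "factors w m = {u. sublist u w \<and> length u = m}"

lemma finite_factors [simp]: "finite (factors w m)"
  by (rule finite_subset[of _ "set (sublists w)"]) (auto simp: factors_def)

lemma factors_conv: "m \<le> length w \<Longrightarrow> factors w m = (\<lambda>i. take m (drop i w)) ` {..length w - m}"
proof (intro set_eqI iffI)
  fix u assume "u \<in> factors w m"
  then obtain ps ss where "w = ps @ u @ ss" "length u = m"
    by (auto simp: factors_def sublist_def)
  then show "u \<in> (\<lambda>i. take m (drop i w)) ` {..length w - m}"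
    by (intro image_eqI[of _ _ "length ps"]) auto
next
  fix u assume "m \<le> length w" "u \<in> (\<lambda>i. take m (drop i w)) ` {..length w - m}"
  then show "u \<in> factors w m"
    by (auto simp: factors_def intro: sublist_order.order_trans[OF sublist_take sublist_drop])
qed

text \<open>The Lyndon words \<open>q\<close> whose periodic word \<open>q q q \<dots>\<close> traces a circuit of length at most \<open>m\<close>
  in the graph with vertices \<open>factors w m\<close> and edges \<open>factors w (Suc m)\<close>\<close>
definition circuits :: "'a :: linorder list \<Rightarrow> nat \<Rightarrow> 'a list set" where
  "circuits w m = {q. lyndon q \<and> length q \<le> m \<and> (\<forall>i. sublist (cyc q i (Suc m)) w)}"

text \<open>Equal edges force equal lengths, by \<open>lyndon_length_le\<close> in both directions.
  Circuits can therefore be counted by these edges.\<close>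

lemma cyc_0_inj_on_circuits: "inj_on (\<lambda>q. cyc q 0 (Suc m)) (circuits w m)"
proof (rule inj_onI)
  fix q r assume qr: "q \<in> circuits w m" "r \<in> circuits w m" "cyc q 0 (Suc m) = cyc r 0 (Suc m)"
  then have "lyndon q" "lyndon r" "q \<noteq> []" "r \<noteq> []" "length q \<le> Suc m" "length r \<le> Suc m"
    by (auto simp: circuits_def lyndon_def)
  with qr(3) show "q = r"
    by (metis lyndon_eqI lyndon_length_le order_antisym)
qed

lemma finite_circuits [simp]: "finite (circuits w m)"
proof (rule inj_on_finite[OF cyc_0_inj_on_circuits])
  show "(\<lambda>q. cyc q 0 (Suc m)) ` circuits w m \<subseteq> factors w (Suc m)"
    by (auto simp: circuits_def factors_def)
qed simp

text \<open>Deleting from the graph the edge \<open>cyc q 0 (Suc m)\<close> for every circuit \<open>q\<close> leaves it connected: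
  of the deleted edges in a cut take one with \<open>length q\<close> minimal. Its circuit crosses the cut a
  second time, and the edge it uses there is not deleted, since the deleted edges on the circuit
  of \<open>q\<close> belong to circuits shorter than \<open>q\<close>.\<close>
lemma card_circuits:
  fixes w :: "'a :: linorder list"
  assumes "m < length w"
  shows "card (circuits w m) + card (factors w m) \<le> Suc (card (factors w (Suc m)))"
proof -
  define D where "D = (\<lambda>q. cyc q 0 (Suc m)) ` circuits w m"
  have D: "D \<subseteq> factors w (Suc m)" "card D = card (circuits w m)"
    using card_image[OF cyc_0_inj_on_circuits] by (auto simp: D_def circuits_def factors_def)
  have "card (factors w m) \<le> Suc (card (factors w (Suc m) - D))"
  proof (rule card_le_Suc_card_connected[where a = "take m" and b = "drop 1"])
    fix e assume "e \<in> factors w (Suc m) - D"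
    then have "sublist e w" "length e = Suc m" by (auto simp: factors_def)
    then show "take m e \<in> factors w m \<and> drop 1 e \<in> factors w m"
      using sublist_order.order_trans sublist_take sublist_drop
      by (auto simp: factors_def)
  next
    fix S assume S: "S \<subset> factors w m" "S \<noteq> {}"
    define X where "X = {e \<in> factors w (Suc m). (take m e \<in> S) \<noteq> (drop 1 e \<in> S)}"
    define v where "v i = take m (drop i w)" for i
    have V: "factors w m = v ` {..length w - m}"
      using assms by (simp add: factors_conv v_def)
    \<comment> \<open>Reading \<open>w\<close> from left to right is a walk through all vertices, so
      it crosses the cut.\<close>
    have "\<exists>i<length w - m. (v i \<in> S) \<noteq> (v (Suc i) \<in> S)"
    proof (rule ccontr)
      assume *: "\<not> ?thesis"
      have "v i \<in> S \<longleftrightarrow> v 0 \<in> S" if "i \<le> length w - m" for i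
        using that * by (induction i) auto
      then show False using S unfolding V by auto
    qed
    then obtain i where i: "i < length w - m" "(v i \<in> S) \<noteq> (v (Suc i) \<in> S)" by blast
    have "take (Suc m) (drop i w) \<in> X"
      using i assms by (auto simp: X_def factors_conv v_def take_drop min_def add.commute)
    then have "X \<noteq> {}" by blast
    have "\<not> X \<subseteq> D"
    proof
      assume XD: "X \<subseteq> D"
      define Q where "Q = {q \<in> circuits w m. cyc q 0 (Suc m) \<in> X}"
      have "Q \<noteq> {}" using \<open>X \<noteq> {}\<close> XD by (auto simp: Q_def D_def)
      then obtain q where q: "q \<in> Q" and min: "\<And>r. r \<in> Q \<Longrightarrow> length q \<le> length r"
        using exists_least_iff[of "\<lambda>n. \<exists>q\<in>Q. length q = n"] by (metis all_not_in_conv leI)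
      have lq: "lyndon q" "length q \<le> m" "q \<noteq> []" "\<And>i. sublist (cyc q i (Suc m)) w"
        using q by (auto simp: Q_def circuits_def lyndon_def)
      define c where "c i = cyc q i m" for i
      have c: "take m (cyc q i (Suc m)) = c i" "drop 1 (cyc q i (Suc m)) = c (Suc i)" for i
        by (simp_all add: take_cyc drop_cyc c_def)
      have "(c 0 \<in> S) \<noteq> (c 1 \<in> S)" using q c[of 0] by (auto simp: Q_def X_def)
      have "\<exists>i. 0 < i \<and> i < length q \<and> (c i \<in> S) \<noteq> (c (Suc i) \<in> S)"
      proof (rule ccontr)
        assume *: "\<not> ?thesis"
        have "c (Suc i) \<in> S \<longleftrightarrow> c 1 \<in> S" if "i < length q" for i
          using that * by (induction i) auto
        from this[of "length q - 1"] have "c (length q) \<in> S \<longleftrightarrow> c 1 \<in> S"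
          using lq by simp
        moreover have "c (length q) = c 0"
          using cyc_add_length[of q 0 m] by (simp add: c_def)
        ultimately show False using \<open>(c 0 \<in> S) \<noteq> (c 1 \<in> S)\<close> by simp
      qed
      then obtain i where i: "0 < i" "i < length q" "(c i \<in> S) \<noteq> (c (Suc i) \<in> S)" by blast
      have "cyc q i (Suc m) \<in> X"
        using i(3) lq c by (auto simp: X_def factors_def)
      then obtain r where r: "r \<in> Q" "cyc r 0 (Suc m) = cyc q i (Suc m)"
        using XD by (force simp: Q_def D_def)
      then have lr: "lyndon r" "length r \<le> m" by (auto simp: Q_def circuits_def)
      have "length r \<le> length q"
        using lyndon_length_le[OF lr(1) lq(3) r(2)] lr by simp
      with min[OF r(1)] have "length r = length q" by simp
      then have "r = q"
        by (rule lyndon_eqI[OF lr(1) lq(1) r(2)]) (use lr in simp)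
      then show False using lyndon_cyc_0_neq[OF lq(1) i(1,2), of "Suc m"] r(2) lq by simp
    qed
    then show "\<exists>e\<in>factors w (Suc m) - D. (take m e \<in> S) \<noteq> (drop 1 e \<in> S)"
      by (auto simp: X_def)
  qed auto
  moreover have "card (factors w (Suc m) - D) = card (factors w (Suc m)) - card D"
    using D by (intro card_Diff_subset) (auto intro: finite_subset)
  moreover have "card D \<le> card (factors w (Suc m))"
    using D by (intro card_mono) auto
  ultimately show ?thesis using D by linarith
qed

text \<open>In the telescoping sum the boundary terms are the single factor of full length and at
  least one letter.\<close>

lemma sum_card_circuits:
  fixes w :: "'a :: linorder list"
  assumes "w \<noteq> []"
  shows "(\<Sum>m\<in>{1..<length w}. card (circuits w m)) \<le> length w - 1"
proof -
  have "(\<Sum>m\<in>{1..<k}. card (circuits w m)) + card (factors w 1) \<le> card (factors w k) + (k - 1)"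
    if "1 \<le> k" "k \<le> length w" for k
    using that
  proof (induction k rule: dec_induct)
    case (step k)
    then show ?case using card_circuits[of k w] by (simp add: sum.atLeastLessThan_Suc)
  qed simp
  from this[of "length w"]
  have "(\<Sum>m\<in>{1..<length w}. card (circuits w m)) + card (factors w 1)
      \<le> card (factors w (length w)) + (length w - 1)"
    using assms by (simp add: Suc_le_eq)
  moreover have "card (factors w (length w)) = 1"
    by (simp add: factors_conv)
  moreover have "factors w 1 \<noteq> {}"
    using assms by (simp add: factors_conv Suc_le_eq)
  then have "card (factors w 1) \<ge> 1"
    by (simp add: Suc_le_eq card_gt_0_iff)
  ultimately show ?thesis by linarith
qed


section \<open>Counting squares\<close>

text \<open>For positive \<open>j\<close>, an element stands for a square whose half is the
  \<open>j\<close>-th power of a conjugate of \<open>q\<close>.\<close>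

definition starts :: "'a list \<Rightarrow> 'a list \<Rightarrow> nat \<Rightarrow> nat set" where
  "starts w q j = {i. i < length q \<and> sublist (cyc q i (2 * (j * length q))) w}"

text \<open>Among the \<open>length q - t\<close> positions up to \<open>i\<close>, one is congruent to an element of \<open>starts w q j\<close>,
  which has more than \<open>t\<close> elements.\<close>
lemma starts_circuit:
  assumes "lyndon q" "0 < j" "t < card (starts w q j)"
  shows "q \<in> circuits w ((2 * j - 1) * length q + t)"
proof -
  define p where "p = length q"
  define A where "A = starts w q j"
  have p: "0 < p" using assms by (auto simp: lyndon_def p_def)
  have A: "A \<subseteq> {..<p}" by (auto simp: A_def starts_def p_def)
  have "card A \<le> p" using card_mono[OF _ A] by simp
  have tp: "t < p" using \<open>card A \<le> p\<close> assms(3) by (simp add: A_def)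
  obtain j' where j': "j = Suc j'" using assms(2) by (cases j) auto
  have "sublist (cyc q i (Suc ((2 * j - 1) * p + t))) w" for i
  proof -
    define x where "x = i mod p"
    have x: "x < p" using p by (simp add: x_def)
    \<comment> \<open>The residues of the \<open>p - t\<close> positions ending at \<open>x\<close>;
      adding \<open>p\<close> avoids truncated subtraction.\<close>
    define B where "B = (\<lambda>\<delta>. (x + p - \<delta>) mod p) ` {..<p - t}"
    have "inj_on (\<lambda>\<delta>. (x + p - \<delta>) mod p) {..<p - t}"
    proof (rule inj_onI)
      fix y z assume yz: "y \<in> {..<p - t}" "z \<in> {..<p - t}" "(x + p - y) mod p = (x + p - z) mod p"
      have "(x + p - y + (y + z)) mod p = (x + p - z + (y + z)) mod p"
        using yz(3) by (metis mod_add_left_eq)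
      then have "(z + (x + p)) mod p = (y + (x + p)) mod p"
        using yz by (simp add: algebra_simps)
      then have "z mod p = y mod p"
        unfolding nat_mod_eq_iff by simp
      then show "y = z" using yz by simp
    qed
    then have "card B = p - t" by (simp add: B_def card_image)
    have B: "B \<subseteq> {..<p}" using p by (auto simp: B_def)
    have "A \<inter> B \<noteq> {}"
    proof
      assume "A \<inter> B = {}"
      then have "card (A \<union> B) = card A + card B"
        using A B by (intro card_Un_disjoint) (auto intro: finite_subset)
      moreover have "card (A \<union> B) \<le> p" using card_mono[of "{..<p}" "A \<union> B"] A B by simp
      ultimately show False using assms(3) tp \<open>card B = p - t\<close> by (simp add: A_def)
    qed
    then obtain \<delta> where \<delta>: "\<delta> < p - t" "(x + p - \<delta>) mod p \<in> A" by (auto simp: B_def)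
    have "sublist (cyc q (x + p - \<delta>) (2 * (j * p))) w"
      using \<delta>(2) by (simp add: A_def starts_def p_def)
    \<comment> \<open>The longer factor starts \<open>\<delta>\<close> letters earlier, and
      \<open>\<delta> + t + 1 \<le> p\<close> leaves room for the shorter one.\<close>
    moreover have "sublist (cyc q (x + p) (Suc ((2 * j - 1) * p + t))) (cyc q (x + p - \<delta>) (2 * (j * p)))"
      using \<delta>(1) by (intro sublist_cyc) (auto simp: j' algebra_simps)
    ultimately have "sublist (cyc q (x + p) (Suc ((2 * j - 1) * p + t))) w"
      by (rule sublist_order.order_trans[rotated])
    then show ?thesis by (simp add: p_def x_def)
  qed
  then show ?thesis using assms j' by (simp add: circuits_def p_def)
qed

lemma distinct_squares_conv_starts:
  fixes w :: "'a :: linorder list"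
  assumes "s \<in> distinct_squares w"
  obtains q j i where "lyndon q" "0 < j" "i \<in> starts w q j" "s = cyc q i (2 * (j * length q))"
proof -
  obtain u where u: "u \<noteq> []" "s = u @ u" "sublist s w"
    using assms by (auto simp: distinct_squares_def is_square_def)
  obtain q i j where q: "lyndon q" "i < length q" "0 < j" "u = cyc q i (j * length q)"
    using lyndon_root[OF u(1)] .
  have "cyc q (i + j * length q) (j * length q) = u"
    unfolding q(4) using cyc_mod[of q "i + j * length q"] cyc_mod[of q i] by simp
  then have "s = cyc q i (2 * (j * length q))"
    using q(4) u(2) cyc_append[of q i "j * length q" "j * length q"] by (simp add: mult_2)
  moreover from this have "i \<in> starts w q j" using q(2) u(3) by (simp add: starts_def)
  ultimately show ?thesis using that q(1,3) by blast
qed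

theorem card_distinct_squares_less:
  fixes w :: "'a :: linorder list"
  assumes "w \<noteq> []"
  shows "card (distinct_squares w) < length w"
proof -
  define P where "P = {(q, j). lyndon q \<and> 0 < j \<and> starts w q j \<noteq> {}}"
  \<comment> \<open>\<open>K\<close> indexes the squares. \<open>L\<close> replaces each set of
    starts by an initial segment of the same size, which \<open>f\<close> sends to pairs of an order
    and a circuit.\<close>
  define K where "K = (SIGMA (q, j):P. starts w q j)"
  define L where "L = (SIGMA (q, j):P. {..<card (starts w q j)})"
  define M where "M = (SIGMA m:{1..<length w}. circuits w m)"
  define f where "f = (\<lambda>((q :: 'a list, j), t). ((2 * j - 1) * length q + t, q))"
  have fin: "finite (starts w q j)" "card (starts w q j) \<le> length q" for q j
    using card_mono[of "{..<length q}" "starts w q j"]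
    by (auto simp: starts_def)
  \<comment> \<open>Since \<open>t < length q\<close>, division by \<open>length q\<close> recovers
    \<open>2 * j - 1\<close> and \<open>t\<close>.\<close>
  have "inj_on f L"
  proof (rule inj_onI, clarify)
    fix q j t q' j' t'
    assume *: "((q, j), t) \<in> L" "((q', j'), t') \<in> L" "f ((q, j), t) = f ((q', j'), t')"
    then have [simp]: "q' = q" by (simp add: f_def)
    have t: "t < length q" "t' < length q" using * fin(2)[of q] by (auto simp: L_def intro: less_le_trans)
    have eq: "(2 * j - 1) * length q + t = (2 * j' - 1) * length q + t'"
      using * by (simp add: f_def)
    have "q \<noteq> []" using t by auto
    then have "2 * j - 1 = 2 * j' - 1"
      using arg_cong[OF eq, of "\<lambda>n. n div length q"] t by simp
    moreover from this have "t = t'" using eq by simp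
    ultimately show "((q, j) = (q', j')) \<and> t = t'" using * by (auto simp: L_def P_def)
  qed
  moreover have "f ` L \<subseteq> M"
  proof (intro image_subsetI, unfold split_paired_all)
    fix q j t assume *: "((q, j), t) \<in> L"
    define m where "m = (2 * j - 1) * length q + t"
    have q: "lyndon q" "0 < j" "t < card (starts w q j)" using * by (auto simp: L_def P_def)
    then have c: "q \<in> circuits w m" unfolding m_def by (rule starts_circuit)
    then have "sublist (cyc q 0 (Suc m)) w" "length q \<le> m" "q \<noteq> []"
      by (auto simp: circuits_def lyndon_def)
    moreover from this have "1 \<le> m" by (cases q) auto
    ultimately have "Suc m \<le> length w" "1 \<le> m"
      using sublist_length_le[of "cyc q 0 (Suc m)" w] by auto
    then show "f ((q, j), t) \<in> M" using c by (auto simp: f_def M_def m_def)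
  qed
  moreover have "finite M" by (simp add: M_def)
  ultimately have "finite L" "card L \<le> card M"
    by (rule inj_on_finite, rule card_inj_on_le)
  \<comment> \<open>Each pair in \<open>P\<close> occurs in \<open>L\<close> with
    \<open>t = 0\<close>, so \<open>P\<close> inherits finiteness from \<open>L\<close>.\<close>
  have "P \<subseteq> fst ` L"
    using fin by (force simp: L_def P_def card_gt_0_iff image_iff)
  then have "finite P" using \<open>finite L\<close> finite_surj by blast
  have "distinct_squares w \<subseteq> (\<lambda>((q, j), i). cyc q i (2 * (j * length q))) ` K"
  proof
    fix s assume "s \<in> distinct_squares w"
    then obtain q j i where "lyndon q" "0 < j" "i \<in> starts w q j" "s = cyc q i (2 * (j * length q))"
      by (rule distinct_squares_conv_starts)
    then show "s \<in> (\<lambda>((q, j), i). cyc q i (2 * (j * length q))) ` K"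
      by (intro image_eqI[of _ _ "((q, j), i)"]) (auto simp: K_def P_def)
  qed
  moreover have "finite K" using \<open>finite P\<close> fin by (auto simp: K_def)
  ultimately have "card (distinct_squares w) \<le> card K"
    by (rule surj_card_le[rotated])
  also have "card K = card L"
    using \<open>finite P\<close> fin by (auto simp: K_def L_def split_def)
  also have "\<dots> \<le> card M" by fact
  also have "\<dots> = (\<Sum>m\<in>{1..<length w}. card (circuits w m))"
    by (simp add: M_def)
  also have "\<dots> \<le> length w - 1" by (rule sum_card_circuits[OF assms])
  finally show ?thesis using assms by (cases w) auto
qed

section \<open>Change of alphabet\<close>

lemma card_distinct_squares_map:
  assumes "inj_on f (set x)"
  shows "card (distinct_squares x) \<le> card (distinct_squares (map f x))"
proof (rule card_inj_on_le[where f = "map f"])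
  have "set s \<subseteq> set x" if "s \<in> distinct_squares x" for s
    using that by (auto simp: distinct_squares_def dest: set_mono_sublist)
  then show "inj_on (map f) (distinct_squares x)"
    using assms by (intro inj_onI) (metis inj_on_map_eq_map inj_on_subset le_sup_iff)
  show "map f ` distinct_squares x \<subseteq> distinct_squares (map f x)"
    by (auto simp: distinct_squares_def is_square_def map_mono_sublist)
       (metis map_append map_mono_sublist)
qed (rule finite_distinct_squares)

theorem corollary33:
  fixes A :: "'a set" and x :: "'a list" and n :: nat
  assumes "finite A"
    and "x \<in> lists A"
    and "n > 0"
    and "length x = n"
  shows "int (card (distinct_squares x)) \<le> \<lfloor>11 * real n / 6\<rfloor>"
proof -
  \<comment> \<open>Lyndon words need an ordered alphabet, so the letters of \<open>x\<close> are
    renamed by natural numbers.\<close>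
  obtain f :: "'a \<Rightarrow> nat" where "inj_on f (set x)"
    using finite_imp_inj_to_nat_seg[of "set x"] by auto
  then have "card (distinct_squares x) < n"
    using card_distinct_squares_map card_distinct_squares_less[of "map f x"] assms
    by (fastforce intro: le_less_trans)
  then show ?thesis by (simp add: le_floor_iff)
qed

end
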